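(* Let $p\ge 2$ be an integer and suppose that $u(t,x)=\psi(t)\phi(x)$ is a solution of $$-iu_t=\triangle u+u^p,\qquad x\in\mathbb{T}^d,$$ where $\psi$ is a complex valued function of time and $\phi:\mathbb{T}^d\to\mathbb{C}$. Then either $\psi(t)$ or $\phi(x)$ is a constant function.
   Context: $\mathbb{T}^d=\mathbb{R}^d/\frac{2\pi}{\omega}\mathbb{Z}^d$, $\omega\in\mathbb{R}^d$ (nonzero entries), is the torus with period $2\pi/\omega_j$ in the $j$-th coordinate. The time variable ranges over the interval ($\mathbb{R}$ in the paper's argument) on which the solution is defined, and solutions are understood in the classical sense. *)

theory Defs
  imports "HOL-Analysis.Analysis"
begin

definition period_lattice :: "real ^ 'n \<Rightarrow> (real ^ 'n) set" where
  "period_lattice \<omega> = {v. \<forall>j. \<exists>k::int. v $ j = 2 * pi / \<omega> $ j * of_int k}"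

definition torus_rel :: "real ^ 'n \<Rightarrow> ((real ^ 'n) \<times> (real ^ 'n)) set" where
  "torus_rel \<omega> = {(x, y). x - y \<in> period_lattice \<omega>}"

text \<open>Points of the torus are cosets of the period lattice. A function on the torus has
  type \<open>(real ^ 'n) set \<Rightarrow> complex\<close>; only its values on \<open>torus \<omega>\<close> are meaningful.\<close>

definition torus :: "real ^ 'n \<Rightarrow> (real ^ 'n) set set" where
  "torus \<omega> = UNIV // torus_rel \<omega>"

definition torus_proj :: "real ^ 'n \<Rightarrow> real ^ 'n \<Rightarrow> (real ^ 'n) set" where
  "torus_proj \<omega> x = torus_rel \<omega> `` {x}"

definition partial_deriv :: "'n \<Rightarrow> (real ^ 'n::finite \<Rightarrow> complex) \<Rightarrow> real ^ 'n \<Rightarrow> complex" where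
  "partial_deriv j f x = vector_derivative (\<lambda>s. f (x + s *\<^sub>R axis j 1)) (at 0)"

definition has_partials :: "(real ^ 'n::finite \<Rightarrow> complex) \<Rightarrow> bool" where
  "has_partials f \<longleftrightarrow> (\<forall>j x. (\<lambda>s. f (x + s *\<^sub>R axis j 1)) differentiable (at 0))"

definition C1 :: "(real ^ 'n::finite \<Rightarrow> complex) \<Rightarrow> bool" where
  "C1 f \<longleftrightarrow> continuous_on UNIV f \<and> has_partials f
     \<and> (\<forall>j. continuous_on UNIV (partial_deriv j f))"

definition C2 :: "(real ^ 'n::finite \<Rightarrow> complex) \<Rightarrow> bool" where
  "C2 f \<longleftrightarrow> C1 f \<and> (\<forall>j. C1 (partial_deriv j f))"

definition laplacian :: "(real ^ 'n::finite \<Rightarrow> complex) \<Rightarrow> real ^ 'n \<Rightarrow> complex" where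
  "laplacian f x = (\<Sum>j\<in>UNIV. partial_deriv j (partial_deriv j f) x)"

text \<open>Classical solutions of \<open>- \<i> u\<^sub>t = \<triangle> u + u ^ p\<close> on \<open>I \<times> torus \<omega>\<close>.
  Regularity and derivatives in space are those of the lift \<open>u t \<circ> torus_proj \<omega>\<close> to
  \<open>real ^ 'n\<close>, since the projection is a local diffeomorphism. The time derivative is
  one-sided at an endpoint of \<open>I\<close> that belongs to \<open>I\<close>. Continuity of the derivatives
  jointly in time and space is not required.\<close>

definition classical_solution ::
  "real ^ 'n::finite \<Rightarrow> nat \<Rightarrow> real set \<Rightarrow> (real \<Rightarrow> (real ^ 'n) set \<Rightarrow> complex) \<Rightarrow> bool" where
  "classical_solution \<omega> p I u \<longleftrightarrow>
     (\<forall>t\<in>I. C2 (u t \<circ> torus_proj \<omega>)) \<and>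
     (\<forall>t\<in>I. \<forall>x. \<exists>u\<^sub>t.
        ((\<lambda>s. u s (torus_proj \<omega> x)) has_vector_derivative u\<^sub>t) (at t within I) \<and>
        - \<i> * u\<^sub>t = laplacian (u t \<circ> torus_proj \<omega>) x + u t (torus_proj \<omega> x) ^ p)"

end

theory Submission
  imports Defs
begin

text \<open>Leave aside the trivial cases in which \<open>\<psi>\<close> or \<open>\<phi>\<close> vanishes identically or \<open>I\<close> is a
  single point. With \<open>\<psi> t0 \<noteq> 0\<close>, write the solution as
  \<open>a t * g x\<close> with \<open>a = \<psi> / \<psi> t0\<close> and \<open>g = \<psi> t0 * \<phi>\<close>, where \<open>g\<close> is \<open>C2\<close>. The equation
  at time \<open>t\<close> reads \<open>- \<i> * a' t * g = a t * \<triangle>g + a t ^ p * g ^ p\<close>, and \<open>a t0 = 1\<close>.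
  Subtracting \<open>a t\<close> times the equation at \<open>t0\<close> eliminates the Laplacian and leaves an
  identity
  \<open>\<mu> t * g x = (a t ^ p - a t) * g x ^ p\<close>
  in which \<open>\<mu>\<close> depends on time only. If \<open>a t ^ p \<noteq> a t\<close> for some \<open>t\<close>, then \<open>g\<close> satisfies an
  algebraic equation \<open>g ^ p = c * g\<close>; otherwise \<open>a ^ p = a\<close> at all times. Either way a
  continuous function on a connected set takes its values among the finitely many roots
  of \<open>z ^ p = c * z\<close>, so it is constant.\<close>

lemma finite_roots_power_eq_linear:
  fixes c :: complex
  assumes "p \<ge> 2"
  shows "finite {z. z ^ p = c * z}"
proof (rule finite_subset)
  show "{z. z ^ p = c * z} \<subseteq> insert 0 {z. z ^ (p - 1) = c}"
  proof -
    have "z ^ p = z * z ^ (p - 1)" for z :: complex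
      using assms by (simp flip: power_Suc)
    then show ?thesis by auto
  qed
  show "finite (insert 0 {z. z ^ (p - 1) = c})"
    using assms by (simp add: finite_nth_roots)
qed

lemma constant_on_if_power_eq_linear:
  fixes f :: "'a::topological_space \<Rightarrow> complex"
  assumes "connected S" "continuous_on S f" "p \<ge> 2"
    and "\<And>x. x \<in> S \<Longrightarrow> f x ^ p = c * f x"
  shows "f constant_on S"
proof (rule continuous_finite_range_constant)
  show "finite (f ` S)"
    by (rule finite_subset[OF _ finite_roots_power_eq_linear[OF \<open>p \<ge> 2\<close>, of c]])
       (use assms(4) in auto)
qed (use assms in auto)

lemma partial_deriv_cmult:
  assumes "has_partials f"
  shows "partial_deriv j (\<lambda>x. c * f x) = (\<lambda>x. c * partial_deriv j f x)"
proof
  fix x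
  have "((\<lambda>s. f (x + s *\<^sub>R axis j 1)) has_vector_derivative partial_deriv j f x) (at 0)"
    using assms unfolding has_partials_def partial_deriv_def
    by (simp add: vector_derivative_works)
  then have "((\<lambda>s. c * f (x + s *\<^sub>R axis j 1)) has_vector_derivative c * partial_deriv j f x) (at 0)"
    by (rule has_vector_derivative_mult_right)
  then show "partial_deriv j (\<lambda>x. c * f x) x = c * partial_deriv j f x"
    unfolding partial_deriv_def[of j "\<lambda>x. c * f x"] by (rule vector_derivative_at)
qed

lemma laplacian_cmult:
  assumes "C2 f"
  shows "laplacian (\<lambda>x. c * f x) x = c * laplacian f x"
proof -
  have "has_partials f" and "has_partials (partial_deriv j f)" for j
    using assms by (auto simp: C2_def C1_def)
  then have "partial_deriv j (partial_deriv j (\<lambda>x. c * f x)) x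
      = c * partial_deriv j (partial_deriv j f) x" for j
    by (simp add: partial_deriv_cmult)
  then show ?thesis
    by (simp add: laplacian_def sum_distrib_left)
qed

text \<open>On a nondegenerate interval every point is a limit point, so one-sided derivatives at
  the endpoints are unique too. Hence the time derivative of a product \<open>a t * g x\<close> is
  \<open>a' t * g x\<close> with one function \<open>a'\<close> that serves all points \<open>x\<close>.\<close>

lemma vector_derivative_unique_within_connected:
  assumes "connected I" "t \<in> I" "\<not> (\<exists>a. I = {a})"
    and "(f has_vector_derivative d) (at t within I)"
    and "(f has_vector_derivative e) (at t within I)"
  shows "d = e"
proof (rule vector_derivative_unique_within)
  show "at t within I \<noteq> bot"
    using connected_imp_perfect[of I t] assms(1-3) by (simp add: trivial_limit_within)
qed (use assms in auto)

text \<open>The separated equation in normalised form, posed on the universal cover of the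
  torus and with amplitude 1 at the reference time \<open>t0\<close>: then \<open>g\<close> is itself the solution at
  time \<open>t0\<close> and inherits its regularity.\<close>

lemma separated_solution_constant:
  fixes a :: "real \<Rightarrow> complex" and g :: "real ^ 'n::finite \<Rightarrow> complex"
  assumes "p \<ge> 2" and "is_interval I" and "t0 \<in> I" and "a t0 = 1" and "C2 g"
    and eq: "\<And>t x. t \<in> I \<Longrightarrow> \<exists>d. ((\<lambda>s. a s * g x) has_vector_derivative d) (at t within I) \<and>
        - \<i> * d = laplacian (\<lambda>y. a t * g y) x + (a t * g x) ^ p"
  shows "a constant_on I \<or> g constant_on UNIV"
proof (cases "(\<exists>b. I = {b}) \<or> (\<forall>x. g x = 0)")
  case True
  then show ?thesis by (auto simp: constant_on_def)
next
  case False
  have "connected I"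
    using \<open>is_interval I\<close> by (simp add: is_interval_connected)
  from False obtain x0 where x0: "g x0 \<noteq> 0" by blast
  have "\<exists>d. (a has_vector_derivative d) (at t within I)" if "t \<in> I" for t
  proof -
    obtain d where "((\<lambda>s. a s * g x0) has_vector_derivative d) (at t within I)"
      using eq[OF \<open>t \<in> I\<close>] by blast
    then have "((\<lambda>s. a s * g x0 * inverse (g x0)) has_vector_derivative d * inverse (g x0))
        (at t within I)"
      by (rule has_vector_derivative_mult_left)
    then show ?thesis using x0 by (auto simp: field_simps)
  qed
  then obtain a' where a': "\<And>t. t \<in> I \<Longrightarrow> (a has_vector_derivative a' t) (at t within I)"
    by metis
  have separated: "- \<i> * (a' t * g x) = a t * laplacian g x + a t ^ p * g x ^ p"
    if "t \<in> I" for t x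
  proof -
    obtain d where "((\<lambda>s. a s * g x) has_vector_derivative d) (at t within I)"
      and d: "- \<i> * d = laplacian (\<lambda>y. a t * g y) x + (a t * g x) ^ p"
      using eq[OF \<open>t \<in> I\<close>] by blast
    then have "d = a' t * g x"
      using vector_derivative_unique_within_connected[OF \<open>connected I\<close> \<open>t \<in> I\<close>] False
        has_vector_derivative_mult_left[OF a'[OF \<open>t \<in> I\<close>]] by blast
    then show ?thesis
      using d by (simp add: laplacian_cmult[OF \<open>C2 g\<close>] power_mult_distrib)
  qed
  have no_laplacian: "- \<i> * (a' t - a t * a' t0) * g x = (a t ^ p - a t) * g x ^ p"
    if "t \<in> I" for t x
  proof -
    have "- \<i> * (a' t - a t * a' t0) * g x
        = - \<i> * (a' t * g x) - a t * (- \<i> * (a' t0 * g x))"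
      by (simp add: algebra_simps)
    also have "\<dots> = (a t ^ p - a t) * g x ^ p"
      unfolding separated[OF \<open>t \<in> I\<close>] separated[OF \<open>t0 \<in> I\<close>]
      by (simp add: \<open>a t0 = 1\<close> algebra_simps)
    finally show ?thesis .
  qed
  show ?thesis
  proof (cases "\<forall>t\<in>I. a t ^ p = a t")
    case True
    have "continuous_on I a"
      using a' has_vector_derivative_continuous continuous_on_eq_continuous_within by blast
    then have "a constant_on I"
      using True constant_on_if_power_eq_linear[OF \<open>connected I\<close> _ \<open>p \<ge> 2\<close>, of a 1] by simp
    then show ?thesis ..
  next
    case False
    then obtain t where t: "t \<in> I" "a t ^ p - a t \<noteq> 0" by auto
    define c where "c = - \<i> * (a' t - a t * a' t0) / (a t ^ p - a t)"
    have "g x ^ p = c * g x" for x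
      using no_laplacian[OF t(1), of x] t(2) by (simp add: c_def field_simps)
    moreover have "continuous_on UNIV g"
      using \<open>C2 g\<close> by (simp add: C2_def C1_def)
    ultimately have "g constant_on UNIV"
      using constant_on_if_power_eq_linear[OF connected_UNIV _ \<open>p \<ge> 2\<close>] by blast
    then show ?thesis ..
  qed
qed

theorem proposition1p8:
  fixes \<omega> :: "real ^ 'n::finite" and p :: nat and I :: "real set"
    and \<psi> :: "real \<Rightarrow> complex" and \<phi> :: "(real ^ 'n) set \<Rightarrow> complex"
  assumes "\<forall>j. \<omega> $ j \<noteq> 0"
    and "p \<ge> 2"
    and "is_interval I"
    and "classical_solution \<omega> p I (\<lambda>t x. \<psi> t * \<phi> x)"
  shows "\<psi> constant_on I \<or> \<phi> constant_on torus \<omega>"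
proof (cases "\<forall>t\<in>I. \<psi> t = 0")
  case True
  then show ?thesis by (auto simp: constant_on_def)
next
  case False
  then obtain t0 where t0: "t0 \<in> I" "\<psi> t0 \<noteq> 0" by blast
  define a where "a = (\<lambda>t. \<psi> t / \<psi> t0)"
  define g where "g = (\<lambda>x. \<psi> t0 * \<phi> (torus_proj \<omega> x))"
  have ag: "a t * g x = \<psi> t * \<phi> (torus_proj \<omega> x)" for t x
    using t0 by (simp add: a_def g_def)
  have "a constant_on I \<or> g constant_on UNIV"
  proof (rule separated_solution_constant[OF \<open>p \<ge> 2\<close> \<open>is_interval I\<close> \<open>t0 \<in> I\<close>])
    show "a t0 = 1" using t0 by (simp add: a_def)
    show "C2 g"
      using assms(4) t0 by (auto simp: classical_solution_def g_def o_def)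
    show "\<exists>d. ((\<lambda>s. a s * g x) has_vector_derivative d) (at t within I) \<and>
        - \<i> * d = laplacian (\<lambda>y. a t * g y) x + (a t * g x) ^ p" if "t \<in> I" for t x
      using assms(4) that unfolding ag by (auto simp: classical_solution_def o_def)
  qed
  then show ?thesis
  proof
    assume "a constant_on I"
    then obtain k where "\<forall>t\<in>I. \<psi> t = k * \<psi> t0"
      using t0 by (auto simp: constant_on_def a_def field_simps)
    then show ?thesis by (auto simp: constant_on_def)
  next
    assume "g constant_on UNIV"
    then obtain k where k: "\<psi> t0 * \<phi> (torus_proj \<omega> x) = k" for x
      by (auto simp: constant_on_def g_def)
    have "\<phi> X = k / \<psi> t0" if "X \<in> torus \<omega>" for X
    proof -
      obtain x where "X = torus_proj \<omega> x"
        using \<open>X \<in> torus \<omega>\<close> by (auto simp: torus_def torus_proj_def elim: quotientE)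
      then show ?thesis using k[of x] t0 by (simp add: field_simps)
    qed
    then show ?thesis by (auto simp: constant_on_def)
  qed
qed

end
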